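(* For all integers $\ell,m\ge0$, at the midpoint $p=1+i$, $q=1-i$: (i) $s^2g_{\ell,m}'+\bigl(1-(\ell+m)s\bigr)g_{\ell,m}=\widetilde C_{\ell,m}$; (ii) $\widetilde C_{\ell+1,m+1}=\widetilde D_{\ell,m}+2i(\ell-m)\,s\,g_{\ell,m}$ and $\widetilde D_{\ell+1,m+1}=\widetilde C_{\ell,m}+2(\ell+m+1)\,s\,g_{\ell,m}$; (iii) as rational functions of $Z$, $$F_{\ell+2,m+2}(Z)\,\bigl(Z-(\ell+m)-4\bigr)=F_{\ell,m}(Z)\,\bigl(Z+(\ell+m)+2\bigr)+2i(\ell-m)\,F_{\ell+1,m+1}(Z).$$
   Context: Bessel polynomials: $y_n(x)=\sum_{k=0}^n\frac{(n+k)!}{(n-k)!\,k!\,2^k}x^k$ for $n\ge0$, with the convention $y_{-1}=1$. With $p=1+i$, $q=1-i$ put $$g_{\ell,m}(s)=y_\ell(ps)\,y_m(qs)=\sum_{n=0}^{\ell+m}G_n^{(\ell,m)}s^n,\qquad F_{\ell,m}(Z)=\sum_{n=0}^{\ell+m}\frac{G_n^{(\ell,m)}}{(Z-1)(Z-2)\cdots(Z-n)},$$ $$\widetilde C_{\ell,m}(s)=\frac{y_{\ell-1}(ps)\,y_m(qs)}{p}+\frac{y_\ell(ps)\,y_{m-1}(qs)}{q},\qquad \widetilde D_{\ell,m}(s)=\frac{y_\ell(ps)\,y_{m-1}(qs)}{p}+\frac{y_{\ell-1}(ps)\,y_m(qs)}{q}.$$ The prime denotes $d/ds$. *)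

theory Defs
  imports Complex_Main "HOL-Computational_Algebra.Computational_Algebra"
begin

(* The index is an integer so that the convention y_{-1} = 1 can be stated.
   Indices below -1 do not occur; they also give 1. *)
definition bessel_y :: "int \<Rightarrow> complex poly" where
  "bessel_y n =
     (if n < 0 then 1
      else \<Sum>k\<le>nat n. monom (fact (nat n + k) / (fact (nat n - k) * fact k * 2 ^ k)) k)"

definition p_mid :: complex where "p_mid = 1 + \<i>"

definition q_mid :: complex where "q_mid = 1 - \<i>"

(* y_n(c s) as a polynomial in s *)
definition bessel_y_scaled :: "complex \<Rightarrow> int \<Rightarrow> complex poly" where
  "bessel_y_scaled c n = pcompose (bessel_y n) [:0, c:]"

definition g_poly :: "nat \<Rightarrow> nat \<Rightarrow> complex poly" where
  "g_poly l m = bessel_y_scaled p_mid (int l) * bessel_y_scaled q_mid (int m)"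

definition G_coeff :: "nat \<Rightarrow> nat \<Rightarrow> nat \<Rightarrow> complex" where
  "G_coeff l m n = coeff (g_poly l m) n"

definition C_poly :: "nat \<Rightarrow> nat \<Rightarrow> complex poly" where
  "C_poly l m =
     smult (1 / p_mid) (bessel_y_scaled p_mid (int l - 1) * bessel_y_scaled q_mid (int m))
   + smult (1 / q_mid) (bessel_y_scaled p_mid (int l) * bessel_y_scaled q_mid (int m - 1))"

definition D_poly :: "nat \<Rightarrow> nat \<Rightarrow> complex poly" where
  "D_poly l m =
     smult (1 / p_mid) (bessel_y_scaled p_mid (int l) * bessel_y_scaled q_mid (int m - 1))
   + smult (1 / q_mid) (bessel_y_scaled p_mid (int l - 1) * bessel_y_scaled q_mid (int m))"

(* The field of rational functions in Z over the complex numbers is the fraction field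
   of the polynomial ring. *)
type_synonym ratfun = "complex poly fract"

definition Z_rat :: ratfun where "Z_rat = to_fract [:0, 1:]"

definition const_rat :: "complex \<Rightarrow> ratfun" where "const_rat c = to_fract [:c:]"

definition F_rat :: "nat \<Rightarrow> nat \<Rightarrow> ratfun" where
  "F_rat l m = (\<Sum>n\<le>l + m. const_rat (G_coeff l m n) / (\<Prod>j=1..n. Z_rat - of_nat j))"

end

theory Submission
  imports Defs
begin

text \<open>
  Everything rests on two classical identities of the Bessel polynomials, the three-term
  recurrence \<open>y\<^bsub>n+1\<^esub> = (2n+1) x y\<^sub>n + y\<^bsub>n-1\<^esub>\<close> and the derivative formula
  \<open>x\<^sup>2 y\<^sub>n' = (n x - 1) y\<^sub>n + y\<^bsub>n-1\<^esub>\<close>. The convention \<open>y\<^bsub>-1\<^esub> = 1\<close> is the value that makes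
  both hold at \<open>n = 0\<close>. Part (i) is the product rule together with the derivative formula: the
  terms \<open>- y\<^sub>n\<close> contribute \<open>-(1/p + 1/q) g\<close>, and \<open>1/p + 1/q = 1\<close> at the midpoint. Part (ii)
  applies the recurrence once in each product; the coefficients combine through
  \<open>p/q = \<i>\<close> and \<open>q/p = -\<i>\<close>.

  For part (iii), consider the linear functional \<open>L\<close> from polynomials in \<open>s\<close> to rational
  functions of \<open>Z\<close> with \<open>L(1) = Z\<close> and \<open>L(s\<^bsup>n+1\<^esup>) = 1 / ((Z-1)\<dots>(Z-n))\<close>. Then
  \<open>L(s g\<^bsub>l,m\<^esub>) = F\<^bsub>l,m\<^esub>\<close>, and \<open>L(s\<^sup>2 P' + P) = Z L(s P)\<close> for every polynomial \<open>P\<close>, because the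
  values \<open>v\<^sub>n = L(s\<^sup>n)\<close> satisfy \<open>v\<^sub>n = (Z - n) v\<^bsub>n+1\<^esub>\<close>. Hence (i) turns into
  \<open>L(C\<^bsub>l,m\<^esub>) = (Z - (l+m)) F\<^bsub>l,m\<^esub>\<close>. Using (ii) twice gives
  \<open>C\<^bsub>l+2,m+2\<^esub> = C\<^bsub>l,m\<^esub> + 2 (l+m+1) s g\<^bsub>l,m\<^esub> + 2 \<i> (l-m) s g\<^bsub>l+1,m+1\<^esub>\<close>, and applying \<open>L\<close>
  to this identity is exactly (iii).
\<close>

section \<open>Bessel polynomials\<close>

definition bessel_coeff :: "nat \<Rightarrow> nat \<Rightarrow> complex" where
  "bessel_coeff n k = (if k \<le> n then fact (n + k) / (fact (n - k) * fact k * 2 ^ k) else 0)"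

lemma coeff_bessel_y: "coeff (bessel_y (int n)) k = bessel_coeff n k"
  by (simp add: bessel_y_def bessel_coeff_def coeff_sum)

lemma bessel_y_0: "bessel_y 0 = 1"
  by (simp add: bessel_y_def)

lemma bessel_y_neg: "bessel_y (- 1) = 1"
  by (simp add: bessel_y_def)

lemma degree_bessel_y_le: "degree (bessel_y (int n)) \<le> n"
  by (rule degree_le) (simp add: coeff_bessel_y bessel_coeff_def)

text \<open>Once the fractions in a coefficient identity are cleared, the simplifier leaves side
  conditions of these three forms, in characteristic zero.\<close>

lemma positive_nonzero:
  "1 + of_nat k \<noteq> (0 :: complex)" "of_nat k + numeral a \<noteq> (0 :: complex)"
  "numeral a + of_nat k * numeral b \<noteq> (0 :: complex)"
proof -
  have "of_nat (1 + k) \<noteq> (0 :: complex)" "of_nat (k + numeral a) \<noteq> (0 :: complex)"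
    "of_nat (numeral a + k * numeral b) \<noteq> (0 :: complex)"
    by (simp_all only: of_nat_eq_0_iff) simp_all
  then show "1 + of_nat k \<noteq> (0 :: complex)" "of_nat k + numeral a \<noteq> (0 :: complex)"
    "numeral a + of_nat k * numeral b \<noteq> (0 :: complex)"
    by simp_all
qed

lemma bessel_coeff_0: "bessel_coeff n 0 = 1"
  by (simp add: bessel_coeff_def)

text \<open>This is the derivative formula for \<open>y\<^bsub>n+1\<^esub>\<close> at \<open>x\<^bsup>k+1\<^esup>\<close>. For \<open>k \<le> n\<close>, after division
  by \<open>(n+k+1)! / ((n-k)! (k+1)! 2\<^bsup>k+1\<^esup>)\<close> it reads \<open>n + k + 2 = (n - k) + 2 (k + 1)\<close>; at
  \<open>k = n + 1\<close> the factor \<open>n + 1 - k\<close> vanishes, and beyond it every coefficient is zero.\<close>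

lemma bessel_coeff_diff:
  "bessel_coeff (Suc n) (Suc k) =
     bessel_coeff n (Suc k) + (of_nat (Suc n) - of_nat k) * bessel_coeff (Suc n) k"
proof (cases "k \<le> n")
  case False
  then show ?thesis by (cases "k = Suc n") (auto simp: bessel_coeff_def)
next
  case True
  \<comment> \<open>With \<open>d = n - k\<close> as a variable, \<open>(n - k)!\<close> and its neighbours unfold without truncated
    subtraction; \<open>d = 0\<close> is separate because there the coefficient of \<open>y\<^sub>n\<close> at \<open>k + 1\<close> is
    zero.\<close>
  then obtain d where n: "n = k + d" using le_Suc_ex by blast
  show ?thesis
  proof (cases d)
    case 0
    then show ?thesis
      by (simp add: n bessel_coeff_def divide_simps positive_nonzero)
  next
    case (Suc e)
    show ?thesis
      by (simp add: n Suc bessel_coeff_def divide_simps positive_nonzero)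
        (simp add: algebra_simps positive_nonzero)
  qed
qed

text \<open>This is the three-term recurrence for \<open>y\<^bsub>n+2\<^esub>\<close> at \<open>x\<^bsup>k+1\<^esup>\<close>. For \<open>k \<le> n + 1\<close>, after
  division by \<open>(n+k+1)! / ((n+1-k)! (k+1)! 2\<^bsup>k+1\<^esup>)\<close> it reads
  \<open>(n+k+3) (n+k+2) = 2 (k+1) (2n+3) + (n+1-k) (n-k)\<close>; beyond that every coefficient is
  zero.\<close>

lemma bessel_coeff_recurrence:
  "bessel_coeff (Suc (Suc n)) (Suc k) =
     (2 * of_nat (Suc n) + 1) * bessel_coeff (Suc n) k + bessel_coeff n (Suc k)"
proof (cases "k \<le> n")
  case False
  then show ?thesis
    by (cases "k = Suc n") (auto simp: bessel_coeff_def divide_simps positive_nonzero)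
next
  case True
  then obtain d where n: "n = k + d" using le_Suc_ex by blast
  show ?thesis
  proof (cases d)
    case 0
    then show ?thesis
      by (simp add: n bessel_coeff_def divide_simps positive_nonzero)
  next
    case (Suc e)
    show ?thesis
      by (simp add: n Suc bessel_coeff_def divide_simps positive_nonzero)
        (simp add: algebra_simps positive_nonzero)
  qed
qed

lemma bessel_y_recurrence:
  "bessel_y (int n + 1) = smult (2 * of_nat n + 1) ([:0, 1:] * bessel_y (int n)) + bessel_y (int n - 1)"
proof (cases n)
  case 0
  have "bessel_y 1 = [:1, 1:]"
    by (simp add: bessel_y_def monom_altdef one_pCons)
  then show ?thesis by (simp add: 0 bessel_y_0 bessel_y_neg one_pCons)
next
  case (Suc j)
  have shift: "int n + 1 = int (Suc (Suc j))" "int n - 1 = int j" by (simp_all add: Suc)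
  show ?thesis
    unfolding shift
    by (rule poly_eqI)
       (simp add: Suc coeff_bessel_y coeff_pCons bessel_coeff_0 bessel_coeff_recurrence
          del: of_nat_Suc split: nat.split)
qed

lemma bessel_y_derivative:
  "[:0, 1:] ^ 2 * pderiv (bessel_y (int n)) =
     (smult (of_nat n) [:0, 1:] - 1) * bessel_y (int n) + bessel_y (int n - 1)"
proof (cases n)
  case 0
  then show ?thesis by (simp add: bessel_y_0 bessel_y_neg)
next
  case (Suc j)
  have shift: "int n - 1 = int j" by (simp add: Suc)
  have "coeff (pCons 0 (pCons 0 (pderiv (bessel_y (int n))))) i =
      coeff (smult (of_nat n) (pCons 0 (bessel_y (int n))) - bessel_y (int n) + bessel_y (int j)) i"
    for i
  proof (cases i)
    case 0
    then show ?thesis by (simp add: coeff_bessel_y bessel_coeff_0)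
  next
    case (Suc k)
    have "coeff (pCons 0 (pderiv (bessel_y (int n)))) k = of_nat k * bessel_coeff n k"
      by (cases k) (simp_all add: coeff_pderiv coeff_bessel_y)
    moreover have "bessel_coeff n (Suc k) =
        bessel_coeff j (Suc k) + (of_nat n - of_nat k) * bessel_coeff n k"
      unfolding \<open>n = Suc j\<close> by (rule bessel_coeff_diff)
    ultimately show ?thesis
      using Suc by (simp add: coeff_bessel_y algebra_simps)
  qed
  then have "pCons 0 (pCons 0 (pderiv (bessel_y (int n)))) =
      smult (of_nat n) (pCons 0 (bessel_y (int n))) - bessel_y (int n) + bessel_y (int j)"
    by (rule poly_eqI)
  then show ?thesis unfolding shift by (simp add: power2_eq_square algebra_simps)
qed

lemma bessel_y_scaled_recurrence:
  "bessel_y_scaled c (int n + 1) =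
     smult ((2 * of_nat n + 1) * c) ([:0, 1:] * bessel_y_scaled c (int n)) + bessel_y_scaled c (int n - 1)"
  unfolding bessel_y_scaled_def bessel_y_recurrence pcompose_add pcompose_smult pcompose_mult
  by (simp add: pcompose_pCons mult.commute)

lemma bessel_y_scaled_derivative:
  assumes "c \<noteq> 0"
  shows "[:0, 1:] ^ 2 * pderiv (bessel_y_scaled c (int n)) =
     smult (of_nat n) ([:0, 1:] * bessel_y_scaled c (int n))
     + smult (1 / c) (bessel_y_scaled c (int n - 1) - bessel_y_scaled c (int n))"
proof -
  let ?s = "[:0, c:]"
  have "?s ^ 2 * pcompose (pderiv (bessel_y (int n))) ?s =
      pcompose ([:0, 1:] ^ 2 * pderiv (bessel_y (int n))) ?s"
    by (simp add: pcompose_mult pcompose_pCons power2_eq_square)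
  also have "\<dots> = smult (of_nat n) (?s * bessel_y_scaled c (int n))
      - bessel_y_scaled c (int n) + bessel_y_scaled c (int n - 1)"
    unfolding bessel_y_derivative bessel_y_scaled_def
    by (simp add: pcompose_add pcompose_diff pcompose_mult pcompose_pCons pcompose_1
        pcompose_smult algebra_simps)
  finally have *: "smult (1 / c) (?s ^ 2 * pcompose (pderiv (bessel_y (int n))) ?s) =
      smult (1 / c) (smult (of_nat n) (?s * bessel_y_scaled c (int n))
      - bessel_y_scaled c (int n) + bessel_y_scaled c (int n - 1))" by simp
  have "[:0, 1:] ^ 2 * pderiv (bessel_y_scaled c (int n)) =
      smult (1 / c) (?s ^ 2 * pcompose (pderiv (bessel_y (int n))) ?s)"
    using assms
    by (simp add: bessel_y_scaled_def pderiv_pcompose pderiv_pCons power2_eq_square)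
  with * show ?thesis
    using assms by (simp add: smult_diff_right smult_add_right)
qed

lemma degree_g_poly_le: "degree (g_poly l m) \<le> l + m"
proof -
  have "degree (bessel_y_scaled c (int n)) \<le> n" for c n
    using degree_bessel_y_le[of n]
    by (simp add: bessel_y_scaled_def degree_pcompose)
  then show ?thesis
    unfolding g_poly_def by (meson add_mono degree_mult_le order_trans)
qed

section \<open>The identities at the midpoint\<close>

lemma midpoint_nonzero: "p_mid \<noteq> 0" "q_mid \<noteq> 0"
  by (simp_all add: p_mid_def q_mid_def complex_eq_iff)

lemma midpoint_relations:
  "1 / p_mid + 1 / q_mid = 1" "p_mid / q_mid = \<i>" "q_mid / p_mid = - \<i>"
  by (simp_all add: p_mid_def q_mid_def complex_eq_iff Re_divide Im_divide power2_eq_square)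

lemma g_poly_differential_equation:
  "[:0, 1:] ^ 2 * pderiv (g_poly l m) + (1 - of_nat (l + m) * [:0, 1:]) * g_poly l m = C_poly l m"
proof -
  let ?P = "bessel_y_scaled p_mid (int l)" and ?P' = "bessel_y_scaled p_mid (int l - 1)"
  let ?Q = "bessel_y_scaled q_mid (int m)" and ?Q' = "bessel_y_scaled q_mid (int m - 1)"
  let ?s = "[:0, 1:] :: complex poly"
  have split_one: "?P * ?Q = smult (1 / p_mid) (?P * ?Q) + smult (1 / q_mid) (?P * ?Q)"
    by (simp flip: smult_add_left add: midpoint_relations)
  have "?s ^ 2 * pderiv (?P * ?Q) = (?s ^ 2 * pderiv ?P) * ?Q + ?P * (?s ^ 2 * pderiv ?Q)"
    by (simp add: pderiv_mult algebra_simps)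
  also have "\<dots> = of_nat (l + m) * ?s * (?P * ?Q) + C_poly l m
      - (smult (1 / p_mid) (?P * ?Q) + smult (1 / q_mid) (?P * ?Q))"
    unfolding bessel_y_scaled_derivative[OF midpoint_nonzero(1)]
      bessel_y_scaled_derivative[OF midpoint_nonzero(2)] C_poly_def
    by (simp add: of_nat_poly algebra_simps smult_add_left smult_add_right smult_diff_right)
  finally show ?thesis
    unfolding split_one[symmetric] g_poly_def by (simp add: algebra_simps)
qed

lemma C_poly_step:
  "C_poly (l + 1) (m + 1) =
     D_poly l m + smult (2 * \<i> * (of_nat l - of_nat m)) ([:0, 1:] * g_poly l m)"
proof -
  have "(1 / p_mid) * ((2 * of_nat m + 1) * q_mid) + (1 / q_mid) * ((2 * of_nat l + 1) * p_mid)
      = (2 * of_nat m + 1) * (q_mid / p_mid) + (2 * of_nat l + 1) * (p_mid / q_mid)"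
    by simp
  also have "\<dots> = 2 * \<i> * (of_nat l - of_nat m)"
    by (simp add: midpoint_relations algebra_simps)
  finally have c: "2 * \<i> * (of_nat l - of_nat m) =
      (1 / p_mid) * ((2 * of_nat m + 1) * q_mid) + (1 / q_mid) * ((2 * of_nat l + 1) * p_mid)" ..
  have shift: "int (l + 1) - 1 = int l" "int (m + 1) - 1 = int m"
    "int (l + 1) = int l + 1" "int (m + 1) = int m + 1" by simp_all
  show ?thesis
    unfolding C_poly_def D_poly_def shift(1,2) unfolding shift bessel_y_scaled_recurrence c g_poly_def
    by (simp add: smult_add_right smult_add_left algebra_simps)
qed

lemma D_poly_step:
  "D_poly (l + 1) (m + 1) =
     C_poly l m + smult (2 * of_nat (l + m + 1)) ([:0, 1:] * g_poly l m)"
proof -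
  have c: "2 * of_nat (l + m + 1) =
      (1 / p_mid) * ((2 * of_nat l + 1) * p_mid) + (1 / q_mid) * ((2 * of_nat m + 1) * q_mid)"
    by (simp add: midpoint_nonzero)
  have shift: "int (l + 1) - 1 = int l" "int (m + 1) - 1 = int m"
    "int (l + 1) = int l + 1" "int (m + 1) = int m + 1" by simp_all
  show ?thesis
    unfolding C_poly_def D_poly_def shift(1,2) unfolding shift bessel_y_scaled_recurrence c g_poly_def
    by (simp add: smult_add_right smult_add_left algebra_simps)
qed

section \<open>The linear functional behind the inverse factorial series\<close>

lemma const_rat_simps:
  "const_rat 0 = 0" "const_rat (a + b) = const_rat a + const_rat b"
  "const_rat (a * b) = const_rat a * const_rat b" "const_rat (of_nat k) = of_nat k"
proof -
  show "const_rat (of_nat k) = of_nat k"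
  proof (induction k)
    case (Suc k)
    have "[:of_nat (Suc k):] = 1 + [:of_nat k :: complex:]" by (simp add: one_pCons)
    then show ?case using Suc by (simp only: const_rat_def to_fract_add to_fract_1 of_nat_Suc)
  qed (simp add: const_rat_def)
  have "[:a + b:] = [:a:] + [:b:]" "[:a * b:] = [:a:] * [:b:]" by simp_all
  then show "const_rat (a + b) = const_rat a + const_rat b"
    "const_rat (a * b) = const_rat a * const_rat b"
    by (simp_all only: const_rat_def to_fract_add to_fract_mult)
qed (simp add: const_rat_def)

lemma Z_rat_minus_of_nat_nonzero: "Z_rat - of_nat k \<noteq> 0"
proof -
  have "Z_rat - of_nat k = to_fract ([:0, 1:] - [:of_nat k:])"
    by (simp only: to_fract_diff Z_rat_def const_rat_simps(4)[symmetric] const_rat_def)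
  then show ?thesis by simp
qed

text \<open>The value at \<open>0\<close> is the one that extends the relation \<open>v\<^sub>n = (Z - n) v\<^bsub>n+1\<^esub>\<close> to \<open>n = 0\<close>.\<close>

fun moment :: "nat \<Rightarrow> ratfun" where
  "moment 0 = Z_rat"
| "moment (Suc n) = 1 / (\<Prod>j=1..n. Z_rat - of_nat j)"

lemma moment_step: "moment n = (Z_rat - of_nat n) * moment (Suc n)"
proof (cases n)
  case (Suc k)
  then show ?thesis
    using Z_rat_minus_of_nat_nonzero[of "Suc k"] by (simp del: of_nat_Suc)
qed simp

definition moment_functional :: "complex poly \<Rightarrow> ratfun" where
  "moment_functional P = (\<Sum>n\<le>degree P. const_rat (coeff P n) * moment n)"

text \<open>Any truncation beyond the degree gives the same value, so that sums for polynomials of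
  different degrees can be compared term by term.\<close>

lemma moment_functional_eq:
  assumes "degree P \<le> N"
  shows "moment_functional P = (\<Sum>n\<le>N. const_rat (coeff P n) * moment n)"
  unfolding moment_functional_def using assms
  by (intro sum.mono_neutral_left) (auto simp: coeff_eq_0 const_rat_simps)

lemma moment_functional_add:
  "moment_functional (P + Q) = moment_functional P + moment_functional Q"
proof -
  define N where "N = max (degree P) (degree Q)"
  have "degree P \<le> N" "degree Q \<le> N" "degree (P + Q) \<le> N"
    by (auto simp: N_def intro: degree_add_le)
  then show ?thesis
    by (simp add: moment_functional_eq const_rat_simps distrib_right sum.distrib)
qed

lemma moment_functional_smult:
  "moment_functional (smult c P) = const_rat c * moment_functional P"
  by (simp add: moment_functional_eq[of _ "degree P"] const_rat_simps sum_distrib_left mult.assoc)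

lemma moment_functional_times_s:
  assumes "degree P \<le> N"
  shows "moment_functional ([:0, 1:] * P) =
    (\<Sum>n\<le>N. const_rat (coeff P n) * moment (Suc n))"
proof -
  have "degree (pCons 0 P) \<le> Suc N" using assms by (simp add: degree_pCons_le order_trans)
  then have "moment_functional (pCons 0 P) =
      (\<Sum>n\<le>Suc N. const_rat (coeff (pCons 0 P) n) * moment n)" by (rule moment_functional_eq)
  then show ?thesis by (simp add: sum.atMost_Suc_shift const_rat_simps del: sum.atMost_Suc)
qed

text \<open>On \<open>s\<^sup>n\<close> the claim reads \<open>n v\<^bsub>n+1\<^esub> + v\<^sub>n = Z v\<^bsub>n+1\<^esub>\<close>, which is the relation between
  consecutive moments.\<close>

lemma moment_functional_derivation:
  "moment_functional ([:0, 1:] ^ 2 * pderiv P + P) = Z_rat * moment_functional ([:0, 1:] * P)"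
proof -
  let ?N = "degree P"
  have coeff_sP': "coeff (pCons 0 (pderiv P)) n = of_nat n * coeff P n" for n
    by (cases n) (simp_all add: coeff_pderiv)
  have "degree (pCons 0 (pderiv P)) \<le> ?N"
    by (rule degree_le) (simp add: coeff_sP' coeff_eq_0)
  from moment_functional_times_s[OF this]
  have "moment_functional ([:0, 1:] ^ 2 * pderiv P) =
      (\<Sum>n\<le>?N. of_nat n * const_rat (coeff P n) * moment (Suc n))"
    by (simp add: power2_eq_square coeff_sP' const_rat_simps)
  moreover have "moment_functional P =
      (\<Sum>n\<le>?N. const_rat (coeff P n) * ((Z_rat - of_nat n) * moment (Suc n)))"
    unfolding moment_functional_def by (subst moment_step) simp
  ultimately have "moment_functional ([:0, 1:] ^ 2 * pderiv P + P) =
      (\<Sum>n\<le>?N. of_nat n * const_rat (coeff P n) * moment (Suc n)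
        + const_rat (coeff P n) * ((Z_rat - of_nat n) * moment (Suc n)))"
    by (simp only: moment_functional_add sum.distrib)
  also have "\<dots> = (\<Sum>n\<le>?N. Z_rat * (const_rat (coeff P n) * moment (Suc n)))"
    by (intro sum.cong refl) (simp only: algebra_simps)
  also have "\<dots> = Z_rat * moment_functional ([:0, 1:] * P)"
    by (simp only: moment_functional_times_s[OF order_refl] sum_distrib_left)
  finally show ?thesis .
qed

lemma moment_functional_s_g_poly: "moment_functional ([:0, 1:] * g_poly l m) = F_rat l m"
  unfolding moment_functional_times_s[OF degree_g_poly_le] F_rat_def G_coeff_def by simp

lemma moment_functional_C_poly:
  "moment_functional (C_poly l m) = (Z_rat - of_nat (l + m)) * F_rat l m"
proof -
  let ?g = "g_poly l m"
  have "C_poly l m + smult (of_nat (l + m)) ([:0, 1:] * ?g) = [:0, 1:] ^ 2 * pderiv ?g + ?g"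
    unfolding g_poly_differential_equation[symmetric]
    by (simp add: of_nat_poly algebra_simps)
  then have "moment_functional (C_poly l m) + of_nat (l + m) * F_rat l m = Z_rat * F_rat l m"
    using moment_functional_derivation[of ?g]
    by (metis moment_functional_add moment_functional_smult const_rat_simps(4)
        moment_functional_s_g_poly)
  then show ?thesis by (simp add: algebra_simps)
qed

lemma F_rat_recurrence:
  "F_rat (l + 2) (m + 2) * (Z_rat - of_nat (l + m) - 4) =
     F_rat l m * (Z_rat + of_nat (l + m) + 2)
     + const_rat (2 * \<i> * (of_nat l - of_nat m)) * F_rat (l + 1) (m + 1)"
proof -
  let ?c = "2 * \<i> * (of_nat l - of_nat m)"
  have "C_poly (l + 2) (m + 2) =
      C_poly l m + smult (of_nat (2 * (l + m + 1))) ([:0, 1:] * g_poly l m)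
      + smult ?c ([:0, 1:] * g_poly (l + 1) (m + 1))"
    using C_poly_step[of "l + 1" "m + 1"] D_poly_step[of l m] by simp
  then have "moment_functional (C_poly (l + 2) (m + 2)) =
      moment_functional (C_poly l m) + of_nat (2 * (l + m + 1)) * F_rat l m
      + const_rat ?c * F_rat (l + 1) (m + 1)"
    by (simp only: moment_functional_add moment_functional_smult moment_functional_s_g_poly
        const_rat_simps(4))
  then show ?thesis
    unfolding moment_functional_C_poly by (simp add: algebra_simps)
qed

theorem theorem7p1:
  fixes l m :: nat
  shows "([:0, 1:] ^ 2 * pderiv (g_poly l m) + (1 - of_nat (l + m) * [:0, 1:]) * g_poly l m
           = C_poly l m) \<and>
         (C_poly (l + 1) (m + 1)
           = D_poly l m + smult (2 * \<i> * (of_nat l - of_nat m)) ([:0, 1:] * g_poly l m)) \<and>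
         (D_poly (l + 1) (m + 1)
           = C_poly l m + smult (2 * of_nat (l + m + 1)) ([:0, 1:] * g_poly l m)) \<and>
         (F_rat (l + 2) (m + 2) * (Z_rat - of_nat (l + m) - 4)
           = F_rat l m * (Z_rat + of_nat (l + m) + 2)
             + const_rat (2 * \<i> * (of_nat l - of_nat m)) * F_rat (l + 1) (m + 1))"
  by (intro conjI g_poly_differential_equation C_poly_step D_poly_step F_rat_recurrence)

end
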